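(* Let $G_H$ be a connected half-edge ribbon graph (HERG) and $G_H^*$ its geometric dual. Then, in $\mathbb{Z}[a,a^{-1},b]$, $$R_{G_H}(a+1,a,a^{-1},b,1,1)=R_{G_H^*}(a+1,a,a^{-1},b,1,1).$$
   Context: HERGs. A ribbon graph $G(V,E)$ is a (not necessarily orientable) surface with boundary represented as the union of two sets of closed discs, vertices and edges, such that vertices and edges intersect in disjoint line segments, each such segment lies on the boundary of precisely one vertex and one edge, and each edge contains exactly two such segments. A HERG $G_H=G(V,E,H)$ is a ribbon graph with a set $H$ of half-ribbons (HRs): rectangles each attached to a unique vertex disc along one side $s$; the side parallel to $s$ is the external segment of the HR. The underlying half-edge graph (HEG) of $G_H$ is the graph with vertex set $V$, edge set $E$, half-edge set $H$ and the induced incidence relations. A closed face of a HERG is a boundary component meeting no external segment of an HR; an external cycle is a boundary component meeting external segments. $f_{\mathrm{int}}$ and $C_{\mathrm{ext}}$ denote the numbers of closed faces and external cycles. The polynomial $R$. A spanning subgraph $A\subset G_H$ has all the vertices and all the HRs of $G_H$ and an arbitrary subset of its edges. Put $$R_{G_H}(x,y,z,s,w,t)=\sum_{A\subset G_H}(x-1)^{r(G_H)-r(A)}y^{n(A)}z^{k(A)-f_{\mathrm{int}}(A)+n(A)}s^{C_{\mathrm{ext}}(A)}w^{o(A)}t^{|H(A)|},$$ the sum being over all spanning subgraphs, where $k(A)$ is the number of connected components, $r(A)=|V(A)|-k(A)$ the rank, $n(A)=|E(A)|-r(A)$ the nullity, $o(A)=0$ if $A$ is orientable and $1$ otherwise,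 $|H(A)|$ the number of HRs of $A$, and $w^2=w$. The dual $G_H^*$. A HEG cellular embedding of a HEG $\mathcal{G}_H$ in a punctured surface $\Sigma$ (a closed connected surface $\widetilde\Sigma$ minus finitely many disjoint closed discs) is an embedding $\phi$ in $\Sigma\cup\partial\Sigma$ of the completed graph $\bar{\mathcal{G}}$ (obtained by turning each half-edge into an edge ending at a new vertex) such that $\widetilde\Sigma-\phi(\bar{\mathcal{G}})$ is a disjoint union of open discs and the image of $\bar{\mathcal{G}}$ meets $\partial\Sigma$ exactly in the new vertices. It is $h$-proper if the number of half-edges equals the number of punctures and every boundary circle meets $\bar{\mathcal{G}}$ (so exactly one half-edge ends on each boundary circle). The HERG of such an embedding is a small neighbourhood band of the embedded HEG, HRs being neighbourhoods of half-edges. Each connected HERG $G_H$ is the HERG of an $h$-proper HEG cellular embedding of its underlying HEG $\mathcal{G}_H$, unique up to homeomorphism. The geometric dual of an $h$-proper embedding is obtained as follows. Take the geometric dual $\bar{\mathcal{G}}^*$ of $\bar{\mathcal{G}}$ in $\Sigma$: one vertex in each component of $\Sigma-\phi(\bar{\mathcal{G}})$ and, for each edge of $\bar{\mathcal{G}}$, one dual edge crossing it transversally and joining the vertices on its two sides. The dual of each completed half-edge is then a loop, based at some vertex $v^*$, encircling the boundary circle $c$ on which the half-edge ends. Replace each such loop by a half-edge attached to $v^*$ at the place of the loop in the cyclic order around $v^*$ and ending on $c$. This is an $h$-proper HEG cellular embedding in $\Sigma$; its HERG is by definition the dual $G_H^*$ of $G_H$. *)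

theory Defs
  imports "HOL-Library.Poly_Mapping" "HOL-Library.Product_Plus"
begin

section \<open>Half-edge ribbon graphs\<close>

text \<open>
  A HERG is a surface glued from discs along line segments, and it is recorded here by its gluing
  data. A corner is an end point of one of the segments along which a ribbon (edge or half-ribbon)
  is attached to a vertex disc. Such a segment has two corners; hence an edge ribbon has four and a
  half-ribbon two (those of its attaching side).

  \<^item> \<open>seg\<close> sends a corner to the other end of its attaching segment.
  \<^item> \<open>arc\<close> sends a corner to the other end of the free arc of the vertex circle which starts there
    (this is an arc between two consecutive segments, or between the two ends of the only one).
  \<^item> \<open>side\<close> sends a corner of an edge ribbon to the other end of the free side of the ribbon which
    starts there. It has no meaning on the corners of half-ribbons.
  \<^item> \<open>hrc\<close> is the set of the corners of the half-ribbons.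
  \<^item> \<open>verts\<close> is the set of vertex discs. A disc to which no ribbon is attached has no corner.

  The surface need not be orientable: the gluing data carry no orientation of the discs.
\<close>

record ('v, 'c) herg_data =
  verts :: "'v set"
  corners :: "'c set"
  hrc :: "'c set"
  vert_of :: "'c \<Rightarrow> 'v"
  seg :: "'c \<Rightarrow> 'c"
  arc :: "'c \<Rightarrow> 'c"
  side :: "'c \<Rightarrow> 'c"

definition orbit :: "'c set \<Rightarrow> ('c \<Rightarrow> 'c) \<Rightarrow> ('c \<Rightarrow> 'c) \<Rightarrow> 'c \<Rightarrow> 'c set" where
  "orbit C f g x = {y. (x, y) \<in> ({(u, f u) | u. u \<in> C} \<union> {(u, g u) | u. u \<in> C})\<^sup>*}"

text \<open>The corners on one vertex circle are met by walking along it, alternately on attaching segments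
  and free arcs; this is \<open>vert_of_eq_iff\<close>. The axioms on \<open>side\<close> say that the circle of an edge disc is
  cut into two attaching segments alternating with two free sides.\<close>

locale herg =
  fixes G :: "('v, 'c) herg_data"
  assumes finite_verts: "finite (verts G)"
    and finite_corners: "finite (corners G)"
    and hrc_subset: "hrc G \<subseteq> corners G"
    and vert_of_in: "x \<in> corners G \<Longrightarrow> vert_of G x \<in> verts G"
    and seg_in: "x \<in> corners G \<Longrightarrow> seg G x \<in> corners G"
    and seg_seg: "x \<in> corners G \<Longrightarrow> seg G (seg G x) = x"
    and seg_neq: "x \<in> corners G \<Longrightarrow> seg G x \<noteq> x"
    and arc_in: "x \<in> corners G \<Longrightarrow> arc G x \<in> corners G"
    and arc_arc: "x \<in> corners G \<Longrightarrow> arc G (arc G x) = x"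
    and arc_neq: "x \<in> corners G \<Longrightarrow> arc G x \<noteq> x"
    and vert_of_eq_iff: "x \<in> corners G \<Longrightarrow> y \<in> corners G \<Longrightarrow>
      vert_of G x = vert_of G y \<longleftrightarrow> y \<in> orbit (corners G) (seg G) (arc G) x"
    and seg_hrc: "x \<in> hrc G \<Longrightarrow> seg G x \<in> hrc G"
    and side_in: "x \<in> corners G - hrc G \<Longrightarrow> side G x \<in> corners G - hrc G"
    and side_side: "x \<in> corners G - hrc G \<Longrightarrow> side G (side G x) = x"
    and side_neq: "x \<in> corners G - hrc G \<Longrightarrow> side G x \<noteq> x"
    and side_neq_seg: "x \<in> corners G - hrc G \<Longrightarrow> side G x \<noteq> seg G x"
    and side_seg: "x \<in> corners G - hrc G \<Longrightarrow> side G (seg G x) = seg G (side G x)"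

text \<open>An edge is identified with the set of its four corners, a half-ribbon with the set of its two.\<close>

definition edges :: "('v, 'c) herg_data \<Rightarrow> 'c set set" where
  "edges G = (\<lambda>x. {x, seg G x, side G x, seg G (side G x)}) ` (corners G - hrc G)"

definition half_ribbons :: "('v, 'c) herg_data \<Rightarrow> 'c set set" where
  "half_ribbons G = (\<lambda>x. {x, seg G x}) ` hrc G"

section \<open>Invariants of spanning subgraphs\<close>

text \<open>The spanning subgraph with edge set \<open>A\<close>, where \<open>A \<subseteq> edges G\<close>, consists of all vertices, all
  half-ribbons and the edges in \<open>A\<close>.\<close>

definition same_component :: "('v, 'c) herg_data \<Rightarrow> 'c set set \<Rightarrow> ('v \<times> 'v) set" where
  "same_component G A =
     {(vert_of G x, vert_of G (side G x)) | x. x \<in> \<Union>A}\<^sup>* \<inter> verts G \<times> verts G"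

definition num_comp :: "('v, 'c) herg_data \<Rightarrow> 'c set set \<Rightarrow> nat" where
  "num_comp G A = card (verts G // same_component G A)"

definition herg_connected :: "('v, 'c) herg_data \<Rightarrow> bool" where
  "herg_connected G \<longleftrightarrow> num_comp G (edges G) = 1"

text \<open>The truncated subtractions here and in \<open>R\<close> do not truncate for a HERG and \<open>A \<subseteq> edges G\<close>.\<close>

definition rank :: "('v, 'c) herg_data \<Rightarrow> 'c set set \<Rightarrow> nat" where
  "rank G A = card (verts G) - num_comp G A"

definition nullity :: "('v, 'c) herg_data \<Rightarrow> 'c set set \<Rightarrow> nat" where
  "nullity G A = card A - rank G A"

text \<open>
  One steps along the boundary of the spanning subgraph by alternating \<open>arc\<close> with the following map.
  At a corner of an edge in \<open>A\<close> the boundary continues along the side of the edge. If the edge is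
  absent, its attaching segment belongs to the boundary. At a corner of a half-ribbon the boundary
  runs around the half-ribbon, through its external segment, to the other corner.
\<close>

definition bdry_step :: "('v, 'c) herg_data \<Rightarrow> 'c set set \<Rightarrow> 'c \<Rightarrow> 'c" where
  "bdry_step G A x = (if x \<in> \<Union>A then side G x else seg G x)"

text \<open>A boundary component is either given by the set of the corners on it (\<open>Inl\<close>), or it is the
  whole circle of a vertex disc without corners (\<open>Inr\<close>).\<close>

definition bdry_comps :: "('v, 'c) herg_data \<Rightarrow> 'c set set \<Rightarrow> ('c set + 'v) set" where
  "bdry_comps G A =
     Inl ` orbit (corners G) (bdry_step G A) (arc G) ` corners G
     \<union> Inr ` (verts G - vert_of G ` corners G)"

text \<open>A boundary component meets the external segment of a half-ribbon iff it contains a corner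
  (equivalently, both corners) of the half-ribbon.\<close>

definition is_external :: "('v, 'c) herg_data \<Rightarrow> 'c set + 'v \<Rightarrow> bool" where
  "is_external G B \<longleftrightarrow> (\<exists>x \<in> hrc G. \<exists>W. B = Inl W \<and> x \<in> W)"

definition f_int :: "('v, 'c) herg_data \<Rightarrow> 'c set set \<Rightarrow> nat" where
  "f_int G A = card {B \<in> bdry_comps G A. \<not> is_external G B}"

definition C_ext :: "('v, 'c) herg_data \<Rightarrow> 'c set set \<Rightarrow> nat" where
  "C_ext G A = card {B \<in> bdry_comps G A. is_external G B}"

text \<open>An orientation of the discs is a choice, for every corner, whether its attaching segment starts
  or ends there when the vertex circle is traversed positively. Start and end alternate on the vertex
  circles, and for orientations of the edge discs which agree with those of the vertex discs to exist
  they have to alternate on the circles of the edge discs as well.\<close>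

definition orientable :: "('v, 'c) herg_data \<Rightarrow> 'c set set \<Rightarrow> bool" where
  "orientable G A \<longleftrightarrow> (\<exists>start :: 'c \<Rightarrow> bool.
     (\<forall>x \<in> corners G. start (seg G x) \<noteq> start x \<and> start (arc G x) \<noteq> start x) \<and>
     (\<forall>x \<in> \<Union>A. start (side G x) \<noteq> start x))"

definition nonor :: "('v, 'c) herg_data \<Rightarrow> 'c set set \<Rightarrow> nat" where
  "nonor G A = (if orientable G A then 0 else 1)"

text \<open>The exponent of \<open>z\<close> is \<open>k(A) - f_int(A) + n(A)\<close>; it is at least the Euler genus of \<open>A\<close>, hence not
  negative. The polynomial is given by its values in commutative rings; since it is taken modulo
  \<open>w\<^sup>2 = w\<close>, only its values at idempotent \<open>w\<close> are meaningful.\<close>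

definition R :: "('v, 'c) herg_data \<Rightarrow> 'r \<Rightarrow> 'r \<Rightarrow> 'r \<Rightarrow> 'r \<Rightarrow> 'r \<Rightarrow> 'r \<Rightarrow> 'r::comm_ring_1" where
  "R G x y z s w t = (\<Sum>A \<in> Pow (edges G).
     (x - 1) ^ (rank G (edges G) - rank G A) * y ^ nullity G A
     * z ^ (num_comp G A + nullity G A - f_int G A)
     * s ^ C_ext G A * w ^ nonor G A * t ^ card (half_ribbons G))"

section \<open>The geometric dual\<close>

text \<open>
  The h-proper embedding of the underlying half-edge graph has \<open>G\<close> as band neighbourhood, and its faces
  correspond to the boundary components of the HERG.

  Completion turns every half-ribbon into an edge ribbon ending on a new vertex disc, which fills the
  puncture. The corners of the half-ribbon are \<open>Inl x\<close> at the old end and \<open>Inr x\<close> at the new vertex,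
  and \<open>Inl x\<close>, \<open>Inr x\<close> lie on the same side of the ribbon.
\<close>

definition completion :: "('v, 'c) herg_data \<Rightarrow> ('v + 'c set, 'c + 'c) herg_data" where
  "completion G = \<lparr>
     verts = verts G <+> half_ribbons G,
     corners = corners G <+> hrc G,
     hrc = {},
     vert_of = case_sum (\<lambda>x. Inl (vert_of G x)) (\<lambda>x. Inr {x, seg G x}),
     seg = map_sum (seg G) (seg G),
     arc = map_sum (arc G) (seg G),
     side = case_sum (\<lambda>x. if x \<in> hrc G then Inr x else Inl (side G x)) Inl \<rparr>"

text \<open>The geometric dual of a ribbon graph without half-ribbons: its vertex discs are the discs glued
  to the boundary components, and every edge ribbon is attached to them along its formerly free sides.
  The remaining arcs of the new vertex circles are those of the old ones.\<close>

definition geom_dual :: "('v, 'c) herg_data \<Rightarrow> ('c set + 'v, 'c) herg_data" where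
  "geom_dual K = \<lparr>
     verts = bdry_comps K (edges K),
     corners = corners K,
     hrc = {},
     vert_of = (\<lambda>x. Inl (orbit (corners K) (bdry_step K (edges K)) (arc K) x)),
     seg = side K,
     arc = arc K,
     side = seg K \<rparr>"

text \<open>
  Now \<open>K\<close> is the geometric dual of a completion, and \<open>H\<close> is the set of the corners of the half-ribbons
  of the original HERG. The dual of a completed half-edge is a loop ribbon whose two ends
  \<open>{Inl x, Inr x}\<close> and \<open>{Inl x', Inr x'}\<close> are consecutive on the circle of \<open>v\<^sup>*\<close>, separated by the free
  arc from \<open>Inr x\<close> to \<open>Inr x'\<close>, which faces the puncture. The half-ribbon replacing the loop is attached
  along the union of these two ends and that arc. Thus the outer corners \<open>Inl x\<close> and \<open>Inl x'\<close> remain.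
\<close>

definition loops_to_half_ribbons ::
    "'c set \<Rightarrow> ('w, 'c + 'c) herg_data \<Rightarrow> ('w, 'c) herg_data" where
  "loops_to_half_ribbons H K = \<lparr>
     verts = verts K,
     corners = Inl -` corners K,
     hrc = H,
     vert_of = (\<lambda>x. vert_of K (Inl x)),
     seg = (\<lambda>x. projl (if x \<in> H then seg K (arc K (seg K (Inl x))) else seg K (Inl x))),
     arc = (\<lambda>x. projl (arc K (Inl x))),
     side = (\<lambda>x. projl (side K (Inl x))) \<rparr>"

definition dual ::
    "('v, 'c) herg_data \<Rightarrow> (('c + 'c) set + ('v + 'c set), 'c) herg_data" where
  "dual G = loops_to_half_ribbons (hrc G) (geom_dual (completion G))"

section \<open>Laurent polynomials\<close>

text \<open>The ring \<open>\<int>[a, a\<^sup>-\<^sup>1, b]\<close>: finitely supported integer coefficients, indexed by the exponents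
  of \<open>a\<close> (an integer) and \<open>b\<close> (a natural number), with the convolution product.\<close>

type_synonym laurent = "(int \<times> nat) \<Rightarrow>\<^sub>0 int"

definition La :: laurent where "La = Poly_Mapping.single (1, 0) 1"
definition La_inv :: laurent where "La_inv = Poly_Mapping.single (- 1, 0) 1"
definition Lb :: laurent where "Lb = Poly_Mapping.single (0, 1) 1"

lemma La_La_inv: "La * La_inv = 1"
  by (simp add: La_def La_inv_def Poly_Mapping.mult_single zero_prod_def
      flip: Poly_Mapping.single_one)

section \<open>Duals are HERGs\<close>

lemma Union_edges:
  assumes "herg G"
  shows "\<Union> (edges G) = corners G - hrc G"
proof -
  interpret herg G by fact
  have "seg G x \<in> corners G - hrc G" if "x \<in> corners G - hrc G" for x
    using that seg_in[of x] seg_seg[of x] seg_hrc[of "seg G x"] by auto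
  then show ?thesis
    unfolding edges_def using side_in by fastforce
qed

lemma orbit_refl: "x \<in> orbit C f g x"
  by (simp add: orbit_def)

lemma orbit_step1: "y \<in> orbit C f g x \<Longrightarrow> y \<in> C \<Longrightarrow> f y \<in> orbit C f g x"
  unfolding orbit_def by (auto intro: rtrancl_into_rtrancl)

lemma orbit_step2: "y \<in> orbit C f g x \<Longrightarrow> y \<in> C \<Longrightarrow> g y \<in> orbit C f g x"
  unfolding orbit_def by (auto intro: rtrancl_into_rtrancl)

lemma orbit_induct [consumes 1, case_names refl step1 step2]:
  assumes "y \<in> orbit C f g x" "P x"
    and "\<And>u. u \<in> orbit C f g x \<Longrightarrow> u \<in> C \<Longrightarrow> P u \<Longrightarrow> P (f u)"
    and "\<And>u. u \<in> orbit C f g x \<Longrightarrow> u \<in> C \<Longrightarrow> P u \<Longrightarrow> P (g u)"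
  shows "P y"
proof -
  have "(x, y) \<in> ({(u, f u) | u. u \<in> C} \<union> {(u, g u) | u. u \<in> C})\<^sup>*"
    using assms(1) by (simp add: orbit_def)
  then show ?thesis
  proof (induction rule: rtrancl_induct)
    case base show ?case by (rule assms(2))
  next
    case (step y z)
    then have "y \<in> orbit C f g x" by (simp add: orbit_def)
    with step assms(3,4) show ?case by auto
  qed
qed

lemma orbit_trans: "y \<in> orbit C f g x \<Longrightarrow> z \<in> orbit C f g y \<Longrightarrow> z \<in> orbit C f g x"
  unfolding orbit_def by auto

lemma orbit_sym:
  assumes "\<And>u. u \<in> C \<Longrightarrow> f u \<in> C \<and> f (f u) = u" "\<And>u. u \<in> C \<Longrightarrow> g u \<in> C \<and> g (g u) = u"
    and "y \<in> orbit C f g x"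
  shows "x \<in> orbit C f g y"
  using assms(3)
proof (induction rule: orbit_induct)
  case refl show ?case by (rule orbit_refl)
next
  case (step1 u)
  then have "u \<in> orbit C f g (f u)"
    using assms(1)[of u] orbit_step1[OF orbit_refl, of "f u" C f g] by simp
  with step1 show ?case by (blast intro: orbit_trans)
next
  case (step2 u)
  then have "u \<in> orbit C f g (g u)"
    using assms(2)[of u] orbit_step2[OF orbit_refl, of "g u" C g f] by simp
  with step2 show ?case by (blast intro: orbit_trans)
qed

lemma orbit_eq_iff:
  assumes "\<And>u. u \<in> C \<Longrightarrow> f u \<in> C \<and> f (f u) = u" "\<And>u. u \<in> C \<Longrightarrow> g u \<in> C \<and> g (g u) = u"
  shows "orbit C f g x = orbit C f g y \<longleftrightarrow> y \<in> orbit C f g x"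
proof
  show "y \<in> orbit C f g x" if "orbit C f g x = orbit C f g y" using that orbit_refl[of y] by simp
  assume y: "y \<in> orbit C f g x"
  have "x \<in> orbit C f g y" by (rule orbit_sym[OF assms y])
  with y show "orbit C f g x = orbit C f g y" by (metis orbit_trans subsetI subset_antisym)
qed

text \<open>Explicit gluing data of the dual: on edges \<open>seg\<close> and \<open>side\<close> are exchanged, while the two corners
  of each half-ribbon remain the two corners of a half-ribbon.\<close>

lemma dual_simps:
  assumes "herg G"
  shows "corners (dual G) = corners G" "hrc (dual G) = hrc G"
    "x \<in> corners G \<Longrightarrow> seg (dual G) x = bdry_step G (edges G) x"
    "arc (dual G) x = arc G x" "side (dual G) x = seg G x"
    "verts (dual G) = bdry_comps (completion G) (edges (completion G))"
proof -
  interpret herg G by fact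
  show "x \<in> corners G \<Longrightarrow> seg (dual G) x = bdry_step G (edges G) x"
    using seg_hrc[of x] unfolding bdry_step_def Union_edges[OF assms]
    by (simp add: dual_def loops_to_half_ribbons_def geom_dual_def completion_def)
qed (auto simp: dual_def loops_to_half_ribbons_def geom_dual_def completion_def)

lemma herg_completion:
  assumes "herg G"
  shows "herg (completion G)"
proof -
  interpret herg G by fact
  have f: "finite (hrc G)" using finite_subset[OF hrc_subset finite_corners] .
  let ?O = "orbit (corners (completion G)) (seg (completion G)) (arc (completion G))"
  let ?o = "orbit (corners G) (seg G) (arc G)"
  have lr: "case y of Inl v \<Rightarrow> v \<in> ?o u \<and> v \<in> corners G | Inr v \<Rightarrow> False"
    if "y \<in> ?O (Inl u)" "u \<in> corners G" for y u
    using that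
  proof (induction rule: orbit_induct)
    case refl then show ?case by (simp add: orbit_refl)
  next
    case (step1 v) then show ?case
      by (cases v) (auto simp: completion_def intro: orbit_step1 seg_in)
  next
    case (step2 v) then show ?case
      by (cases v) (auto simp: completion_def intro: orbit_step2 arc_in)
  qed
  have rl: "Inl v \<in> ?O (Inl u) \<and> v \<in> corners G" if "v \<in> ?o u" "u \<in> corners G" for v u
    using that
  proof (induction rule: orbit_induct)
    case refl then show ?case by (simp add: orbit_refl)
  next
    case (step1 v)
    then have "seg (completion G) (Inl v) \<in> ?O (Inl u)"
      by (intro orbit_step1) (auto simp: completion_def)
    with step1 show ?case by (auto simp: completion_def seg_in)
  next
    case (step2 v)
    then have "arc (completion G) (Inl v) \<in> ?O (Inl u)"
      by (intro orbit_step2) (auto simp: completion_def)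
    with step2 show ?case by (auto simp: completion_def arc_in)
  qed
  have rr: "y \<in> {Inr u, Inr (seg G u)}" if "y \<in> ?O (Inr u)" "u \<in> hrc G" for y u
    using that
  proof (induction rule: orbit_induct)
    case refl then show ?case by simp
  next
    case (step1 v) then show ?case using hrc_subset seg_seg by (auto simp: completion_def)
  next
    case (step2 v) then show ?case using hrc_subset seg_seg by (auto simp: completion_def)
  qed
  have rr': "Inr (seg G u) \<in> ?O (Inr u)" if "u \<in> hrc G" for u
    using orbit_step1[OF orbit_refl, of "Inr u" "corners (completion G)" "seg (completion G)"] that
    by (auto simp: completion_def)
  have segE: "seg G x \<notin> hrc G" if "x \<in> corners G" "x \<notin> hrc G" for x
    using that seg_seg[of x] seg_hrc[of "seg G x"] by auto
  show ?thesis
  proof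
    fix x y assume xy: "x \<in> corners (completion G)" "y \<in> corners (completion G)"
    show "vert_of (completion G) x = vert_of (completion G) y \<longleftrightarrow> y \<in> ?O x"
    proof (cases x)
      case x: (Inl u)
      then have u: "u \<in> corners G" using xy by (auto simp: completion_def)
      show ?thesis
      proof (cases y)
        case y: (Inl v)
        then have v: "v \<in> corners G" using xy by (auto simp: completion_def)
        show ?thesis using lr[of y u] rl[of v u] vert_of_eq_iff[OF u v] x y u
          by (auto simp: completion_def)
      next
        case (Inr v) then show ?thesis using lr[of y u] x u by (auto simp: completion_def)
      qed
    next
      case x: (Inr u)
      then have u: "u \<in> hrc G" using xy by (auto simp: completion_def)
      then have uc: "u \<in> corners G" using hrc_subset by auto
      show ?thesis
      proof (cases y)
        case y: (Inl v)
        then show ?thesis using rr[of y u] x u by (auto simp: completion_def)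
      next
        case y: (Inr v)
        have "{u, seg G u} = {v, seg G v} \<longleftrightarrow> v = u \<or> v = seg G u"
          using seg_seg[OF uc] by auto
        then show ?thesis using rr[of y u] rr'[of u] x y u orbit_refl[of x]
          by (auto simp: completion_def)
      qed
    qed
  next
    fix x assume x: "x \<in> corners (completion G)"
    have i: "u \<in> hrc G \<Longrightarrow> u \<in> corners G" for u using hrc_subset by auto
    show "vert_of (completion G) x \<in> verts (completion G)"
      using x vert_of_in by (auto simp: completion_def half_ribbons_def)
    show "seg (completion G) x \<in> corners (completion G)"
      using x seg_in seg_hrc by (auto simp: completion_def)
    show "seg (completion G) (seg (completion G) x) = x"
      using x seg_seg i by (auto simp: completion_def)
    show "seg (completion G) x \<noteq> x"
      using x seg_neq i by (auto simp: completion_def)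
    show "arc (completion G) x \<in> corners (completion G)"
      using x arc_in seg_hrc by (auto simp: completion_def)
    show "arc (completion G) (arc (completion G) x) = x"
      using x arc_arc seg_seg i by (auto simp: completion_def)
    show "arc (completion G) x \<noteq> x"
      using x arc_neq seg_neq i by (auto simp: completion_def)
  next
    fix x assume x: "x \<in> corners (completion G) - hrc (completion G)"
    then consider
      u where "x = Inl u" "u \<in> corners G" "u \<in> hrc G" "seg G u \<in> hrc G"
      | u where "x = Inl u" "u \<in> corners G" "u \<notin> hrc G" "seg G u \<notin> hrc G"
          "side G u \<in> corners G" "side G u \<notin> hrc G"
      | u where "x = Inr u" "u \<in> corners G" "u \<in> hrc G" "seg G u \<in> hrc G"
    proof (cases x)
      case (Inl u)
      then have "u \<in> corners G" using x by (auto simp: completion_def)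
      then show ?thesis using Inl that(1,2)[of u] seg_hrc[of u] segE[of u] side_in[of u] by blast
    next
      case (Inr u)
      then have "u \<in> hrc G" using x by (auto simp: completion_def)
      then show ?thesis using Inr that(3)[of u] seg_hrc[of u] hrc_subset by blast
    qed
    note * = this
    show "side (completion G) x \<in> corners (completion G) - hrc (completion G)"
      by (cases rule: *) (simp_all add: completion_def InlI InrI)
    show "side (completion G) (side (completion G) x) = x"
      by (cases rule: *) (simp_all add: completion_def side_side)
    show "side (completion G) x \<noteq> x"
      by (cases rule: *) (simp_all add: completion_def side_neq)
    show "side (completion G) x \<noteq> seg (completion G) x"
      by (cases rule: *) (simp_all add: completion_def side_neq_seg)
    show "side (completion G) (seg (completion G) x) = seg (completion G) (side (completion G) x)"
      by (cases rule: *) (simp_all add: completion_def side_seg)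
  next
    show "finite (verts (completion G))" "finite (corners (completion G))"
      using finite_verts finite_corners f by (simp_all add: completion_def half_ribbons_def)
  qed (simp_all add: completion_def)
qed

lemma herg_geom_dual:
  assumes "herg K" "hrc K = {}"
  shows "herg (geom_dual K)"
proof -
  interpret herg K by fact
  have side: "x \<in> corners K \<Longrightarrow> side K x \<in> corners K \<and> side K (side K x) = x" for x
    using side_in[of x] side_side[of x] assms(2) by auto
  have arc: "x \<in> corners K \<Longrightarrow> arc K x \<in> corners K \<and> arc K (arc K x) = x" for x
    using arc_in[of x] arc_arc[of x] by auto
  have bs: "x \<in> corners K \<Longrightarrow> bdry_step K (edges K) x = side K x" for x
    unfolding bdry_step_def Union_edges[OF assms(1)] using assms(2) by simp
  have orb: "orbit (corners K) (bdry_step K (edges K)) (arc K) = orbit (corners K) (side K) (arc K)"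
  proof -
    have "{(u, bdry_step K (edges K) u) | u. u \<in> corners K} = {(u, side K u) | u. u \<in> corners K}"
      using bs by auto
    then show ?thesis by (simp add: orbit_def fun_eq_iff)
  qed
  have eq: "orbit (corners K) (side K) (arc K) x = orbit (corners K) (side K) (arc K) y
      \<longleftrightarrow> y \<in> orbit (corners K) (side K) (arc K) x" for x y
    by (rule orbit_eq_iff) (use side arc in auto)
  show ?thesis
  proof
    show "finite (verts (geom_dual K))"
      using finite_verts finite_corners by (simp add: geom_dual_def bdry_comps_def)
  next
    fix x assume x: "x \<in> corners (geom_dual K) - hrc (geom_dual K)"
    then have xK: "x \<in> corners K" by (simp add: geom_dual_def)
    show "side (geom_dual K) x \<noteq> seg (geom_dual K) x"
      using side_neq_seg[of x] xK assms(2) by (auto simp: geom_dual_def)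
    show "side (geom_dual K) (seg (geom_dual K) x) = seg (geom_dual K) (side (geom_dual K) x)"
      using side_seg[of x] xK assms(2) by (auto simp: geom_dual_def)
  next
    fix x assume "x \<in> corners (geom_dual K)"
    then have x: "x \<in> corners K" by (simp add: geom_dual_def)
    show "vert_of (geom_dual K) x \<in> verts (geom_dual K)"
      using x by (simp add: geom_dual_def bdry_comps_def)
    show "seg (geom_dual K) x \<in> corners (geom_dual K)"
      "seg (geom_dual K) (seg (geom_dual K) x) = x"
      using side[OF x] by (simp_all add: geom_dual_def)
    show "seg (geom_dual K) x \<noteq> x" using side_neq[of x] x assms(2) by (simp add: geom_dual_def)
    show "arc (geom_dual K) x \<in> corners (geom_dual K)"
      "arc (geom_dual K) (arc (geom_dual K) x) = x"
      using arc[OF x] by (simp_all add: geom_dual_def)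
    show "arc (geom_dual K) x \<noteq> x" using arc_neq[OF x] by (simp add: geom_dual_def)
  next
    fix x assume "x \<in> corners (geom_dual K) - hrc (geom_dual K)"
    then have x: "x \<in> corners K" by (simp add: geom_dual_def)
    show "side (geom_dual K) x \<in> corners (geom_dual K) - hrc (geom_dual K)"
      "side (geom_dual K) (side (geom_dual K) x) = x" "side (geom_dual K) x \<noteq> x"
      using seg_in[OF x] seg_seg[OF x] seg_neq[OF x] by (simp_all add: geom_dual_def)
  next
    fix x y
    show "vert_of (geom_dual K) x = vert_of (geom_dual K) y \<longleftrightarrow>
        y \<in> orbit (corners (geom_dual K)) (seg (geom_dual K)) (arc (geom_dual K)) x"
      by (simp add: geom_dual_def orb eq)
  qed (use finite_corners in \<open>simp_all add: geom_dual_def\<close>)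
qed

lemma herg_dual:
  assumes "herg G"
  shows "herg (dual G)"
proof -
  interpret herg G by fact
  let ?K = "geom_dual (completion G)"
  have K: "herg ?K"
    by (rule herg_geom_dual[OF herg_completion[OF assms]]) (simp add: completion_def)
  interpret K: herg ?K by fact
  let ?o = "orbit (corners G) (seg (dual G)) (arc G)"
  let ?O = "orbit (corners ?K) (seg ?K) (arc ?K)"
  note ds = dual_simps[OF assms]
  have o: "orbit (corners (dual G)) (seg (dual G)) (arc (dual G)) = ?o"
    using ds(4) by (simp add: ds(1) ext[of "arc (dual G)" "arc G"])
  have bs: "bdry_step G (edges G) x = (if x \<in> hrc G then seg G x else side G x)"
    if "x \<in> corners G" for x
    unfolding bdry_step_def Union_edges[OF assms] using that by simp
  have segE: "seg G x \<notin> hrc G" if "x \<in> corners G" "x \<notin> hrc G" for x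
    using that seg_seg[of x] seg_hrc[of "seg G x"] by auto
  have KI: "corners ?K = corners G <+> hrc G"
    "seg ?K (Inl x) = (if x \<in> hrc G then Inr x else Inl (side G x))" "seg ?K (Inr x) = Inl x"
    "arc ?K (Inl x) = Inl (arc G x)" "arc ?K (Inr x) = Inr (seg G x)" for x
    by (auto simp: geom_dual_def completion_def)
  have down: "(case_sum id id y) \<in> ?o u" if "y \<in> ?O (Inl u)" "u \<in> corners G" for y u
    using that
  proof (induction rule: orbit_induct)
    case refl then show ?case by (simp add: orbit_refl)
  next
    case (step1 v)
    show ?case
    proof (cases v)
      case (Inl w)
      then have w: "w \<in> corners G" "w \<in> ?o u" using step1 by (auto simp: KI)
      have "seg (dual G) w \<in> ?o u" using w by (intro orbit_step1) (auto simp: ds)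
      with w Inl show ?thesis by (auto simp: KI ds bs split: if_splits)
    next
      case (Inr w)
      with step1 show ?thesis by (auto simp: KI)
    qed
  next
    case (step2 v)
    show ?case
    proof (cases v)
      case (Inl w)
      then have w: "w \<in> corners G" "w \<in> ?o u" using step2 by (auto simp: KI)
      have "arc G w \<in> ?o u" using w by (intro orbit_step2) auto
      with Inl show ?thesis by (auto simp: KI ds)
    next
      case (Inr w)
      then have w: "w \<in> hrc G" "w \<in> corners G" "w \<in> ?o u"
        using step2 hrc_subset by (auto simp: KI)
      have "seg (dual G) w \<in> ?o u" using w by (intro orbit_step1) (auto simp: ds)
      with w Inr show ?thesis by (auto simp: KI ds bs)
    qed
  qed
  have up: "v \<in> corners G \<and> Inl v \<in> ?O (Inl u)" if "v \<in> ?o u" "u \<in> corners G" for v u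
    using that
  proof (induction rule: orbit_induct)
    case refl then show ?case by (simp add: orbit_refl)
  next
    case (step1 v)
    then have v: "v \<in> corners G" "Inl v \<in> ?O (Inl u)" by auto
    have s: "seg ?K (Inl v) \<in> ?O (Inl u)" using v by (intro orbit_step1) (auto simp: KI)
    show ?case
    proof (cases "v \<in> hrc G")
      case True
      then have "Inr v \<in> ?O (Inl u)" using s by (simp only: KI if_True)
      moreover have "Inr v \<in> corners ?K" using True by (simp add: KI InrI)
      ultimately have "arc ?K (Inr v) \<in> ?O (Inl u)" by (rule orbit_step2)
      then have "Inr (seg G v) \<in> ?O (Inl u)" by (simp only: KI)
      moreover have "Inr (seg G v) \<in> corners ?K" using seg_hrc[OF True] by (simp add: KI InrI)
      ultimately have "seg ?K (Inr (seg G v)) \<in> ?O (Inl u)" by (rule orbit_step1)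
      then have "Inl (seg G v) \<in> ?O (Inl u)" by (simp only: KI)
      moreover have "seg (dual G) v = seg G v" using v True by (simp add: ds bs)
      ultimately show ?thesis using seg_in[OF v(1)] by simp
    next
      case False
      then have "Inl (side G v) \<in> ?O (Inl u)" using s by (simp only: KI if_False)
      moreover have "seg (dual G) v = side G v" using v False by (simp add: ds bs)
      moreover have "side G v \<in> corners G" using side_in[of v] v False by simp
      ultimately show ?thesis by simp
    qed
  next
    case (step2 v)
    then have v: "v \<in> corners G" "Inl v \<in> ?O (Inl u)" by auto
    have "arc ?K (Inl v) \<in> ?O (Inl u)" using v by (intro orbit_step2) (auto simp: KI)
    then show ?case using v arc_in by (simp add: KI ds)
  qed
  have vo: "vert_of (dual G) x = vert_of ?K (Inl x)" for x
    by (simp add: dual_def loops_to_half_ribbons_def)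
  have vd: "verts (dual G) = verts ?K"
    by (simp add: dual_def loops_to_half_ribbons_def)
  show ?thesis
  proof
    show "finite (verts (dual G))" using K.finite_verts by (simp add: vd)
  next
    fix x assume "x \<in> corners (dual G)"
    then show "vert_of (dual G) x \<in> verts (dual G)"
      using K.vert_of_in[of "Inl x"] by (simp add: vd vo KI ds InlI)
  next
    fix x y assume "x \<in> corners (dual G)" "y \<in> corners (dual G)"
    then have xy: "x \<in> corners G" "y \<in> corners G" by (auto simp: ds)
    then show "vert_of (dual G) x = vert_of (dual G) y
        \<longleftrightarrow> y \<in> orbit (corners (dual G)) (seg (dual G)) (arc (dual G)) x"
      unfolding o using K.vert_of_eq_iff[of "Inl x" "Inl y"] down[of "Inl y" x] up[of y x]
      by (auto simp: vo KI)
  next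
    fix x assume "x \<in> hrc (dual G)"
    then show "seg (dual G) x \<in> hrc (dual G)" using seg_hrc hrc_subset by (auto simp: ds bs)
  next
    fix x assume "x \<in> corners (dual G)"
    then have x: "x \<in> corners G" by (simp add: ds)
    have d: "x \<notin> hrc G \<Longrightarrow> side G x \<in> corners G - hrc G" using x side_in by auto
    show "seg (dual G) x \<in> corners (dual G)" using x d seg_in by (auto simp: ds bs)
    show "seg (dual G) (seg (dual G) x) = x"
      using x d seg_in seg_hrc seg_seg side_side by (cases "x \<in> hrc G") (auto simp: ds bs)
    show "seg (dual G) x \<noteq> x" using x seg_neq side_neq by (auto simp: ds bs)
    show "arc (dual G) x \<in> corners (dual G)" using x arc_in by (simp add: ds)
    show "arc (dual G) (arc (dual G) x) = x" using x arc_arc by (simp add: ds)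
    show "arc (dual G) x \<noteq> x" using x arc_neq by (simp add: ds)
  next
    fix x assume "x \<in> corners (dual G) - hrc (dual G)"
    then have x: "x \<in> corners G" "x \<notin> hrc G" by (auto simp: ds)
    have d: "side G x \<in> corners G - hrc G" using x side_in by auto
    show "side (dual G) x \<in> corners (dual G) - hrc (dual G)"
      using x seg_in segE by (simp add: ds)
    show "side (dual G) (side (dual G) x) = x" using x seg_seg by (simp add: ds)
    show "side (dual G) x \<noteq> x" using x seg_neq by (simp add: ds)
    show "side (dual G) x \<noteq> seg (dual G) x" using x side_neq_seg[of x] by (simp add: ds bs)
    show "side (dual G) (seg (dual G) x) = seg (dual G) (side (dual G) x)"
      using x d seg_in segE side_seg by (simp add: ds bs)
  qed (use finite_corners hrc_subset in \<open>simp_all add: ds\<close>)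
qed

end

theory Submission
  imports Defs
begin

text \<open>
  At the given arguments the ranks, nullities and component numbers cancel from the exponents, and the
  spanning subgraph \<open>A\<close> of a connected HERG contributes \<open>a\<^sup>-\<^sup>1 * a ^ f_int A * b ^ C_ext A\<close>. The truncated
  subtraction in the exponent of \<open>z\<close> makes this depend on the Euler inequality, which is proved by
  adding the edges of \<open>A\<close> one by one. The gluing data of the dual exchange \<open>seg\<close> and \<open>side\<close> on the
  edges, so the complement of \<open>A\<close> in the dual has the same boundary components as \<open>A\<close>. The dual is
  connected because \<open>seg\<close>, \<open>arc\<close> and \<open>side\<close> together connect the same corners in both.
\<close>

section \<open>Classes of a symmetric relation\<close>

text \<open>One count for two uses: vertices under \<open>adjacency\<close> give components, corners
  under \<open>bdry_rel\<close> give boundary components. Adding an edge can then be treated by the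
  same lemmas in both.\<close>

definition num_classes :: "'a set \<Rightarrow> ('a \<times> 'a) set \<Rightarrow> nat" where
  "num_classes C S = card ((\<lambda>x. S\<^sup>* `` {x}) ` C)"

text \<open>Equal fibres make the passage from a value of \<open>f\<close> to the value of
  \<open>g\<close> at any preimage a well-defined bijection.\<close>

lemma card_image_eq_if_same_fibres:
  assumes "\<And>x y. x \<in> C \<Longrightarrow> y \<in> C \<Longrightarrow> f x = f y \<longleftrightarrow> g x = g y"
  shows "card (f ` C) = card (g ` C)"
proof (rule bij_betw_same_card)
  have *: "f (inv_into C g (g x)) = f x" if "x \<in> C" for x
    using that assms[of "inv_into C g (g x)" x] by (simp add: f_inv_into_f inv_into_into)
  show "bij_betw (\<lambda>v. g (inv_into C f v)) (f ` C) (g ` C)"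
  proof (rule bij_betw_byWitness[where f' = "\<lambda>v. f (inv_into C g v)"])
    have "g (inv_into C f (f x)) = g x" if "x \<in> C" for x
      using that assms[of "inv_into C f (f x)" x] by (simp add: f_inv_into_f inv_into_into)
    with * show "\<forall>a\<in>f ` C. f (inv_into C g (g (inv_into C f a))) = a"
      "\<forall>a\<in>g ` C. g (inv_into C f (f (inv_into C g a))) = a"
      by (auto simp: f_inv_into_f)
  qed (auto intro: inv_into_into)
qed

lemma rtrancl_classes_eq_iff:
  assumes "sym S"
  shows "S\<^sup>* `` {x} = S\<^sup>* `` {y} \<longleftrightarrow> (x, y) \<in> S\<^sup>*"
proof -
  have "(u, v) \<in> S\<^sup>* \<Longrightarrow> (v, u) \<in> S\<^sup>*" for u v
    using symD[OF sym_rtrancl[OF assms]] .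
  then show ?thesis by (auto intro: rtrancl_trans)
qed

text \<open>Only the classes of \<open>p\<close> and \<open>q\<close> are merged. The right side
  absorbs every step of the enlarged relation.\<close>

lemma rtrancl_add_sym_pair:
  assumes "sym S"
  shows "(S \<union> {(p, q), (q, p)})\<^sup>* = S\<^sup>* \<union> (S\<^sup>* `` {p} \<union> S\<^sup>* `` {q}) \<times> (S\<^sup>* `` {p} \<union> S\<^sup>* `` {q})" (is "?L = ?R")
proof
  have sym: "(u, v) \<in> S\<^sup>* \<Longrightarrow> (v, u) \<in> S\<^sup>*" for u v
    using symD[OF sym_rtrancl[OF assms]] .
  show "?L \<subseteq> ?R"
  proof (rule subrelI)
    fix x y assume "(x, y) \<in> ?L"
    then show "(x, y) \<in> ?R"
    proof (induction rule: rtrancl_induct)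
      case (step y z)
      then show ?case using sym[of x p] sym[of x q] by (auto intro: rtrancl_into_rtrancl)
    qed simp
  qed
  have up: "(u, v) \<in> S\<^sup>* \<Longrightarrow> (u, v) \<in> ?L" for u v
    by (meson in_mono rtrancl_mono sup_ge1)
  have pq: "(p, q) \<in> ?L" "(q, p) \<in> ?L" by auto
  \<comment> \<open>Everything in the two classes is linked to \<open>p\<close> both ways, so any
    two of these points are linked through \<open>p\<close>.\<close>
  have via_p: "(u, p) \<in> ?L \<and> (p, u) \<in> ?L" if "u \<in> S\<^sup>* `` {p} \<union> S\<^sup>* `` {q}" for u
    using that pq up[of p u] up[of q u] sym[THEN up, of p u] sym[THEN up, of q u] rtrancl_trans
    unfolding Un_iff Image_singleton_iff by metis
  have pairs: "(u, v) \<in> ?L"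
    if "u \<in> S\<^sup>* `` {p} \<union> S\<^sup>* `` {q}" "v \<in> S\<^sup>* `` {p} \<union> S\<^sup>* `` {q}" for u v
    using via_p[OF that(1)] via_p[OF that(2)] rtrancl_trans[of u p] by blast
  show "?R \<subseteq> ?L"
  proof (intro Un_least subrelI)
    show "(u, v) \<in> ?L" if "(u, v) \<in> S\<^sup>*" for u v using that by (rule up)
    show "(u, v) \<in> ?L" if "(u, v) \<in> (S\<^sup>* `` {p} \<union> S\<^sup>* `` {q}) \<times> (S\<^sup>* `` {p} \<union> S\<^sup>* `` {q})" for u v
      using that pairs by (simp only: mem_Times_iff fst_conv snd_conv)
  qed
qed

lemma num_classes_add_pair_same:
  assumes "sym S" "(p, q) \<in> S\<^sup>*"
  shows "num_classes C (S \<union> {(p, q), (q, p)}) = num_classes C S"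
proof -
  have "(q, p) \<in> S\<^sup>*" by (rule symD[OF sym_rtrancl[OF assms(1)] assms(2)])
  then have "(S \<union> {(p, q), (q, p)})\<^sup>* = S\<^sup>*"
    using assms(2) by (intro rtrancl_subset) auto
  then show ?thesis by (simp add: num_classes_def)
qed

text \<open>The class of \<open>p\<close> is absorbed into that of \<open>q\<close>, and all other
  classes are unaffected.\<close>

lemma num_classes_add_pair_diff:
  assumes "finite C" "sym S" "p \<in> C" "q \<in> C" "(p, q) \<notin> S\<^sup>*"
  shows "num_classes C S = Suc (num_classes C (S \<union> {(p, q), (q, p)}))"
proof -
  let ?S' = "S \<union> {(p, q), (q, p)}"
  let ?cl = "\<lambda>x. S\<^sup>* `` {x}" and ?cl' = "\<lambda>x. ?S'\<^sup>* `` {x}"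
  note eq = rtrancl_classes_eq_iff[OF assms(2)]
  have sym: "(u, v) \<in> S\<^sup>* \<Longrightarrow> (v, u) \<in> S\<^sup>*" for u v
    using symD[OF sym_rtrancl[OF assms(2)]] .
  have "sym ?S'" using assms(2) by (auto simp: sym_def)
  note eq' = rtrancl_classes_eq_iff[OF this]
  note S' = rtrancl_add_sym_pair[OF assms(2), of p q]
  \<comment> \<open>\<open>D\<close> omits the old class of \<open>p\<close> but contains
    \<open>q\<close>. Hence it meets every new class and every old class except that of
    \<open>p\<close>, and on \<open>D\<close> both relations have the same classes.\<close>
  define D where "D = {x \<in> C. (p, x) \<notin> S\<^sup>*}"
  have q: "q \<in> D" using assms by (simp add: D_def)
  have "?cl' ` C = ?cl' ` D"
  proof -
    have "?cl' x \<in> ?cl' ` D" if "x \<in> C" "x \<notin> D" for x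
    proof -
      have "?cl' x = ?cl' q" unfolding eq' S' using that by (auto simp: D_def)
      with q show ?thesis by blast
    qed
    then show ?thesis by (auto simp: D_def)
  qed
  moreover have "card (?cl' ` D) = card (?cl ` D)"
  proof (rule card_image_eq_if_same_fibres)
    fix x y assume "x \<in> D" "y \<in> D"
    then show "?cl' x = ?cl' y \<longleftrightarrow> ?cl x = ?cl y"
      unfolding eq eq' S' D_def using rtrancl_trans[OF sym] by blast
  qed
  moreover have "?cl ` C = insert (?cl p) (?cl ` D)"
  proof -
    have "?cl x = ?cl p" if "x \<in> C" "x \<notin> D" for x
      unfolding eq using that sym by (simp add: D_def)
    then have "?cl ` C \<subseteq> insert (?cl p) (?cl ` D)" by blast
    moreover have "D \<subseteq> C" by (auto simp: D_def)
    ultimately show ?thesis using assms(3) by blast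
  qed
  moreover have "?cl p \<notin> ?cl ` D"
    unfolding image_iff eq by (simp add: D_def)
  moreover have "finite D" using assms(1) by (simp add: D_def)
  ultimately show ?thesis by (simp add: num_classes_def)
qed

text \<open>The induction splits off one pair \<open>x\<close>, \<open>f x\<close> at a
  time.\<close>

lemma even_card_if_fixpoint_free_involution:
  assumes "finite X" "\<And>x. x \<in> X \<Longrightarrow> f x \<in> X \<and> f (f x) = x \<and> f x \<noteq> x"
  shows "even (card X)"
  using assms
proof (induction "card X" arbitrary: X rule: less_induct)
  case less
  show ?case
  proof (cases "X = {}")
    case False
    then obtain x where x: "x \<in> X" by blast
    let ?Y = "X - {x, f x}"
    have fx: "f x \<in> X" "f (f x) = x" "f x \<noteq> x" using less.prems(2)[OF x] by auto
    have "insert x (insert (f x) ?Y) = X" using x fx by blast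
    moreover have "card (insert x (insert (f x) ?Y)) = Suc (Suc (card ?Y))"
      using fx(3) less.prems(1) by (simp add: card_insert_if)
    ultimately have card: "card X = Suc (Suc (card ?Y))" by simp
    have "even (card ?Y)"
    proof (rule less.hyps)
      show "finite ?Y" using less.prems(1) by simp
      fix y assume "y \<in> ?Y"
      with less.prems(2)[of y] fx show "f y \<in> ?Y \<and> f (f y) = y \<and> f y \<noteq> y" by auto
    qed (use card in simp)
    with card show ?thesis by simp
  qed simp
qed

section \<open>Rewiring a pair of involutions\<close>

abbreviation steps :: "'a set \<Rightarrow> ('a \<Rightarrow> 'a) \<Rightarrow> ('a \<times> 'a) set" where
  "steps C f \<equiv> {(u, f u) | u. u \<in> C}"

lemma orbit_eq_Image: "orbit C f g x = (steps C f \<union> steps C g)\<^sup>* `` {x}"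
  by (auto simp: orbit_def)

lemma orbit_cong:
  assumes "\<And>u. u \<in> C \<Longrightarrow> f u = f' u" "\<And>u. u \<in> C \<Longrightarrow> g u = g' u"
  shows "orbit C f g = orbit C f' g'"
proof -
  have "steps C f = steps C f'" "steps C g = steps C g'" using assms by auto
  then show ?thesis by (simp add: orbit_def fun_eq_iff)
qed

text \<open>A perfect matching of \<open>C\<close>. On a finite set two matchings together form
  disjoint alternating cycles; boundary components arise in this way from \<open>bdry_step\<close>
  and \<open>arc\<close>.\<close>

definition fpf_involution :: "'a set \<Rightarrow> ('a \<Rightarrow> 'a) \<Rightarrow> bool" where
  "fpf_involution C f \<longleftrightarrow> (\<forall>u \<in> C. f u \<in> C \<and> f (f u) = u \<and> f u \<noteq> u)"

lemma fpf_involutionD: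
  assumes "fpf_involution C f" "u \<in> C"
  shows "f u \<in> C" "f (f u) = u" "f u \<noteq> u"
  using assms by (auto simp: fpf_involution_def)

lemma sym_steps: "fpf_involution C f \<Longrightarrow> sym (steps C f)"
  by (rule symI) (auto simp: fpf_involution_def)

text \<open>The pairs \<open>p q\<close>, \<open>r s\<close> of \<open>f\<close> become
  \<open>p r\<close>, \<open>q s\<close> in \<open>f'\<close>. With \<open>p\<close>,
  \<open>q\<close> joined as well, the steps of \<open>f'\<close> link all four points:
  \<open>r\<close> reaches \<open>s\<close> through \<open>p\<close> and \<open>q\<close>.
  Exchanging the roles of \<open>f\<close> and \<open>f'\<close> gives the reverse
  inclusion.\<close>

lemma rewire_subset:
  assumes "f p = q" "f q = p" "f r = s" "f s = r"
    and "f' p = r" "f' r = p" "f' q = s" "f' s = q"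
    and "p \<in> C" "q \<in> C" "r \<in> C" "s \<in> C"
    and off: "\<And>u. u \<notin> {p, q, r, s} \<Longrightarrow> u \<in> C \<Longrightarrow> f u = f' u"
  shows "(steps C f \<union> T \<union> {(p, r), (r, p)})\<^sup>* \<subseteq> (steps C f' \<union> T \<union> {(p, q), (q, p)})\<^sup>*"
    (is "_ \<subseteq> ?R\<^sup>*")
proof (rule rtrancl_subset_rtrancl, rule subsetI)
  have step: "(u, f' u) \<in> ?R\<^sup>*" if "u \<in> C" for u using that by auto
  have pq: "(p, q) \<in> ?R\<^sup>*" "(q, p) \<in> ?R\<^sup>*" by auto
  have pr: "(p, r) \<in> ?R\<^sup>*" "(r, p) \<in> ?R\<^sup>*" using step[of p] step[of r] assms by simp_all
  have qs: "(q, s) \<in> ?R\<^sup>*" "(s, q) \<in> ?R\<^sup>*" using step[of q] step[of s] assms by simp_all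
  have rs: "(r, s) \<in> ?R\<^sup>*" "(s, r) \<in> ?R\<^sup>*"
    using rtrancl_trans[OF rtrancl_trans[OF pr(2) pq(1)] qs(1)]
      rtrancl_trans[OF rtrancl_trans[OF qs(2) pq(2)] pr(1)] .
  have fstep: "(u, f u) \<in> ?R\<^sup>*" if "u \<in> C" for u
    using that step[of u] off[of u] pq rs assms(1-4) by (cases "u \<in> {p, q, r, s}") auto
  fix z assume "z \<in> steps C f \<union> T \<union> {(p, r), (r, p)}"
  then show "z \<in> ?R\<^sup>*" using fstep pr by auto
qed

text \<open>A path leaving \<open>p\<close> along \<open>g\<close> and alternating \<open>g\<close> and \<open>f\<close> can only end at a rewired point, for
  otherwise the set of its points has even cardinality by \<open>g\<close> and odd cardinality by \<open>f\<close>.\<close>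

lemma rewire_connects:
  assumes "finite C" and f: "fpf_involution C f" and g: "fpf_involution C g"
    and "f p = q" "f r = s" "p \<in> C" "r \<in> C"
    and off: "\<And>u. u \<notin> {p, q, r, s} \<Longrightarrow> u \<in> C \<Longrightarrow> f u = f' u"
    and sep: "(p, r) \<notin> (steps C f \<union> steps C g)\<^sup>*"
  shows "(p, q) \<in> (steps C f' \<union> steps C g)\<^sup>*"
proof -
  \<comment> \<open>Without the \<open>f\<close>-steps at the four points the relation lies in both
    the old and the new one: \<open>MF\<close> lets \<open>sep\<close> be applied,
    \<open>MF'\<close> yields the conclusion.\<close>
  let ?M = "steps (C - {p, q, r, s}) f \<union> steps C g"
  define D where "D = ?M\<^sup>* `` {p}"
  have MF: "?M\<^sup>* \<subseteq> (steps C f \<union> steps C g)\<^sup>*" by (rule rtrancl_mono) auto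
  have "?M \<subseteq> steps C f' \<union> steps C g" using off by auto
  then have MF': "?M\<^sup>* \<subseteq> (steps C f' \<union> steps C g)\<^sup>*" by (rule rtrancl_mono)
  have "q \<in> D"
  proof (rule ccontr)
    assume q: "q \<notin> D"
    have DC: "D \<subseteq> C"
    proof
      fix u assume "u \<in> D"
      then have "(p, u) \<in> ?M\<^sup>*" by (simp add: D_def)
      then show "u \<in> C"
        by (induction rule: rtrancl_induct) (use assms(6) fpf_involutionD[OF f] fpf_involutionD[OF g] in auto)
    qed
    have r: "r \<notin> D" using sep MF by (auto simp: D_def)
    have s: "s \<notin> D"
    proof
      assume "s \<in> D"
      then have "(p, s) \<in> (steps C f \<union> steps C g)\<^sup>*" using MF by (auto simp: D_def)
      moreover have "(s, r) \<in> steps C f"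
        using fpf_involutionD[OF f assms(7)] assms(5) by auto
      ultimately show False using sep by (meson UnI1 rtrancl_into_rtrancl)
    qed
    have fin: "finite D" using DC assms(1) by (rule finite_subset)
    have "even (card D)"
    proof (rule even_card_if_fixpoint_free_involution[OF fin, of g])
      fix u assume u: "u \<in> D"
      then have "u \<in> C" using DC by auto
      moreover have "(u, g u) \<in> ?M" using \<open>u \<in> C\<close> by auto
      then have "g u \<in> D" using u unfolding D_def Image_singleton_iff by (rule rtrancl_into_rtrancl[rotated])
      ultimately show "g u \<in> D \<and> g (g u) = u \<and> g u \<noteq> u" using fpf_involutionD[OF g] by simp
    qed
    \<comment> \<open>The partner \<open>q\<close> of \<open>p\<close> is assumed to lie outside
      \<open>D\<close>, and so do \<open>r\<close> and \<open>s\<close>. Hence \<open>f\<close>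
      pairs up the rest of \<open>D\<close>.\<close>
    moreover have "even (card (D - {p}))"
    proof (rule even_card_if_fixpoint_free_involution[of _ f])
      fix u assume u: "u \<in> D - {p}"
      then have uC: "u \<in> C" using DC by auto
      have "u \<notin> {p, q, r, s}" using u q r s by auto
      then have "(u, f u) \<in> ?M" using uC by auto
      moreover have "(p, u) \<in> ?M\<^sup>*" using u by (simp add: D_def)
      ultimately have "f u \<in> D" unfolding D_def Image_singleton_iff by (rule rtrancl_into_rtrancl[rotated])
      moreover have "f u \<noteq> p"
        using fpf_involutionD(2)[OF f uC] assms(4) u q by auto
      ultimately show "f u \<in> D - {p} \<and> f (f u) = u \<and> f u \<noteq> u"
        using fpf_involutionD[OF f uC] by simp
    qed (use fin in simp)
    moreover have "p \<in> D" by (simp add: D_def)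
    then have "card D = Suc (card (D - {p}))" using fin by (metis card.remove)
    ultimately show False by simp
  qed
  then show ?thesis using MF' by (auto simp: D_def)
qed

text \<open>Joining \<open>p\<close>, \<open>r\<close> in \<open>F\<close> and joining
  \<open>p\<close>, \<open>q\<close> in \<open>F'\<close> give the same closure. Each junction
  lowers the count by at most one, so both counts are compared with that common value. This models a
  ribbon whose two attaching segments give way to its two free sides.\<close>

lemma num_classes_rewire:
  assumes "finite C" and f: "fpf_involution C f" and f': "fpf_involution C f'" and g: "fpf_involution C g"
    and vals: "f p = q" "f r = s" "f' p = r" "f' q = s" and in_C: "p \<in> C" "q \<in> C" "r \<in> C"
    and off: "\<And>u. u \<notin> {p, q, r, s} \<Longrightarrow> u \<in> C \<Longrightarrow> f u = f' u"
  defines "F \<equiv> steps C f \<union> steps C g" and "F' \<equiv> steps C f' \<union> steps C g"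
  shows "num_classes C F' \<le> Suc (num_classes C F)"
    and "(p, r) \<notin> F\<^sup>* \<Longrightarrow> num_classes C F = Suc (num_classes C F')"
proof -
  have symF: "sym F" and symF': "sym F'"
    unfolding F_def F'_def using f f' g by (simp_all add: sym_steps sym_Un)
  have inv: "f q = p" "f s = r" "f' r = p" "f' s = q" "s \<in> C"
    using vals in_C fpf_involutionD[OF f] fpf_involutionD[OF f'] by metis+
  let ?U = "F \<union> {(p, r), (r, p)}" and ?U' = "F' \<union> {(p, q), (q, p)}"
  have "?U\<^sup>* = ?U'\<^sup>*"
    unfolding F_def F'_def
  proof (rule subset_antisym)
    note * = vals inv in_C
    show "(steps C f \<union> steps C g \<union> {(p, r), (r, p)})\<^sup>* \<subseteq> (steps C f' \<union> steps C g \<union> {(p, q), (q, p)})\<^sup>*"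
      by (rule rewire_subset[of f p q r s f']) (simp_all only: *, rule off)
    have off': "f' u = f u" if "u \<notin> {p, r, q, s}" "u \<in> C" for u using off[of u] that by auto
    show "(steps C f' \<union> steps C g \<union> {(p, q), (q, p)})\<^sup>* \<subseteq> (steps C f \<union> steps C g \<union> {(p, r), (r, p)})\<^sup>*"
      by (rule rewire_subset[of f' p r q s f]) (simp_all only: *, rule off')
  qed
  then have U: "num_classes C ?U = num_classes C ?U'" by (simp add: num_classes_def)
  show "num_classes C F' \<le> Suc (num_classes C F)"
    using num_classes_add_pair_same[OF symF, of p r C] num_classes_add_pair_diff[OF assms(1) symF, of p r]
      num_classes_add_pair_same[OF symF', of p q C] num_classes_add_pair_diff[OF assms(1) symF', of p q]
      U in_C by linarith
  assume sep: "(p, r) \<notin> F\<^sup>*"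
  have "(p, q) \<in> F'\<^sup>*"
    unfolding F'_def using assms(1) f g vals(1,2) in_C(1,3) off sep[unfolded F_def]
    by (rule rewire_connects)
  then show "num_classes C F = Suc (num_classes C F')"
    using num_classes_add_pair_diff[OF assms(1) symF in_C(1,3) sep]
      num_classes_add_pair_same[OF symF', of p q C] U by simp
qed

section \<open>The Euler inequality\<close>

context herg
begin

section \<open>Edges and boundary steps in terms of involutions\<close>

lemma seg_not_hrc: "x \<in> corners G - hrc G \<Longrightarrow> seg G x \<in> corners G - hrc G"
  using seg_hrc[of "seg G x"] seg_seg[of x] seg_in[of x] by auto

text \<open>On edge corners \<open>seg\<close> and \<open>side\<close> are commuting involutions, so
  an edge is an orbit of the group they generate and can be written from any of its corners.\<close>

lemma edge_corner:
  assumes "e \<in> edges G" "x \<in> e"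
  shows "x \<in> corners G - hrc G" and "e = {x, seg G x, side G x, seg G (side G x)}"
proof -
  obtain y where y: "y \<in> corners G - hrc G" and e: "e = {y, seg G y, side G y, seg G (side G y)}"
    using assms(1) by (auto simp: edges_def)
  have "seg G y \<in> corners G - hrc G" "side G y \<in> corners G - hrc G"
    "seg G (side G y) \<in> corners G - hrc G"
    using y seg_not_hrc side_in by blast+
  moreover have "seg G (seg G y) = y" "side G (side G y) = y" "side G (seg G y) = seg G (side G y)"
    "seg G (seg G (side G y)) = side G y" "side G (seg G (side G y)) = seg G y"
    using y \<open>side G y \<in> corners G - hrc G\<close> seg_seg side_side side_seg by auto
  ultimately show "x \<in> corners G - hrc G" "e = {x, seg G x, side G x, seg G (side G x)}"
    using y assms(2) unfolding e by auto
qed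

lemma edges_disjoint: "e \<in> edges G \<Longrightarrow> e' \<in> edges G \<Longrightarrow> x \<in> e \<Longrightarrow> x \<in> e' \<Longrightarrow> e = e'"
  by (metis edge_corner(2))

lemma finite_edges: "finite (edges G)"
  using finite_corners by (simp add: edges_def)

lemma Union_corner:
  assumes "A \<subseteq> edges G" "x \<in> \<Union>A"
  shows "x \<in> corners G - hrc G" "seg G x \<in> \<Union>A" "side G x \<in> \<Union>A"
proof -
  obtain e where e: "e \<in> A" "x \<in> e" using assms by blast
  then have "e \<in> edges G" using assms by blast
  note edge_corner[OF this e(2)]
  then show "x \<in> corners G - hrc G" "seg G x \<in> \<Union>A" "side G x \<in> \<Union>A"
    using e(1) by blast+
qed

lemma fpf_involution_arc: "fpf_involution (corners G) (arc G)"
  using arc_in arc_arc arc_neq by (simp add: fpf_involution_def)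

text \<open>The corners of the edges in \<open>A\<close> are closed under \<open>seg\<close> and
  \<open>side\<close>, so the two branches of \<open>bdry_step\<close> do not mix.\<close>

lemma fpf_involution_bdry_step:
  assumes "A \<subseteq> edges G"
  shows "fpf_involution (corners G) (bdry_step G A)"
  unfolding fpf_involution_def
proof
  fix x assume x: "x \<in> corners G"
  show "bdry_step G A x \<in> corners G \<and> bdry_step G A (bdry_step G A x) = x \<and> bdry_step G A x \<noteq> x"
  proof (cases "x \<in> \<Union>A")
    case True
    with Union_corner[OF assms True] show ?thesis
      using side_in[of x] side_side[of x] side_neq[of x] by (simp add: bdry_step_def)
  next
    case False
    then have "seg G x \<notin> \<Union>A" using Union_corner(2)[OF assms, of "seg G x"] seg_seg[OF x] by auto
    with False show ?thesis
      using x seg_in[of x] seg_seg[of x] seg_neq[of x] by (simp add: bdry_step_def)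
  qed
qed

lemma vert_of_seg: "x \<in> corners G \<Longrightarrow> vert_of G (seg G x) = vert_of G x"
  using vert_of_eq_iff[of x "seg G x"] seg_in orbit_step1[OF orbit_refl] by metis

lemma vert_of_arc: "x \<in> corners G \<Longrightarrow> vert_of G (arc G x) = vert_of G x"
  using vert_of_eq_iff[of x "arc G x"] arc_in orbit_step2[OF orbit_refl] by metis

end

section \<open>Components and boundary components as classes\<close>

definition adjacency :: "('v, 'c) herg_data \<Rightarrow> 'c set set \<Rightarrow> ('v \<times> 'v) set" where
  "adjacency G A = {(vert_of G x, vert_of G (side G x)) | x. x \<in> \<Union>A}"

definition bdry_rel :: "('v, 'c) herg_data \<Rightarrow> 'c set set \<Rightarrow> ('c \<times> 'c) set" where
  "bdry_rel G A = steps (corners G) (bdry_step G A) \<union> steps (corners G) (arc G)"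

definition isolated :: "('v, 'c) herg_data \<Rightarrow> 'v set" where
  "isolated G = verts G - vert_of G ` corners G"

text \<open>The second summand does not depend on \<open>A\<close>, so only the classes of corners
  change when an edge is added.\<close>

lemma card_bdry_comps:
  fixes G :: "('v, 'c) herg_data"
  assumes "finite (corners G)" "finite (verts G)"
  shows "card (bdry_comps G A) = num_classes (corners G) (bdry_rel G A) + card (isolated G)"
proof -
  have "card (bdry_comps G A)
      = card (Inl ` orbit (corners G) (bdry_step G A) (arc G) ` corners G :: ('c set + 'v) set)
        + card (Inr ` isolated G :: ('c set + 'v) set)"
    unfolding bdry_comps_def isolated_def using assms by (intro card_Un_disjoint) auto
  then show ?thesis
    by (simp add: card_image num_classes_def orbit_eq_Image bdry_rel_def)
qed

context herg
begin

lemma sym_adjacency: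
  assumes "A \<subseteq> edges G"
  shows "sym (adjacency G A)"
proof (rule symI)
  fix v w assume "(v, w) \<in> adjacency G A"
  then obtain x where x: "x \<in> \<Union>A" "v = vert_of G x" "w = vert_of G (side G x)"
    by (auto simp: adjacency_def)
  with Union_corner[OF assms x(1)] side_side[of x]
  show "(w, v) \<in> adjacency G A" unfolding adjacency_def by force
qed

lemma adjacency_verts:
  assumes "A \<subseteq> edges G"
  shows "adjacency G A \<subseteq> verts G \<times> verts G"
proof -
  have "vert_of G x \<in> verts G" if "x \<in> \<Union>A" for x
    using Union_corner(1)[OF assms that] vert_of_in by auto
  then show ?thesis using Union_corner(3)[OF assms] unfolding adjacency_def by blast
qed

text \<open>Paths from a vertex stay in \<open>verts G\<close>; the restriction in
  \<open>same_component\<close> only discards reflexive pairs.\<close>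

lemma same_component_Image:
  assumes "A \<subseteq> edges G" "v \<in> verts G"
  shows "same_component G A `` {v} = (adjacency G A)\<^sup>* `` {v}"
proof -
  have "w \<in> verts G" if "(v, w) \<in> (adjacency G A)\<^sup>*" for w
    using that assms(2) by (induction rule: rtrancl_induct) (use adjacency_verts[OF assms(1)] in auto)
  then show ?thesis using assms(2) by (auto simp: same_component_def adjacency_def)
qed

lemma num_comp_eq_num_classes:
  assumes "A \<subseteq> edges G"
  shows "num_comp G A = num_classes (verts G) (adjacency G A)"
proof -
  have "verts G // same_component G A = (\<lambda>v. (adjacency G A)\<^sup>* `` {v}) ` verts G"
    using same_component_Image[OF assms] by (auto simp: quotient_def)
  then show ?thesis by (simp add: num_comp_def num_classes_def)
qed

text \<open>A boundary walk keeps to a vertex disc along \<open>arc\<close> and \<open>seg\<close>,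
  and follows an edge of \<open>A\<close> along \<open>side\<close>. The contrapositive shows that
  an edge between two components touches two different boundary components.\<close>

lemma bdry_rel_same_component:
  assumes A: "A \<subseteq> edges G" and "(x, y) \<in> (bdry_rel G A)\<^sup>*" "x \<in> corners G"
  shows "y \<in> corners G \<and> (vert_of G x, vert_of G y) \<in> (adjacency G A)\<^sup>*"
  using assms(2)
proof (induction rule: rtrancl_induct)
  case (step y z)
  then have y: "y \<in> corners G" by simp
  from step(2) consider "z = arc G y" | "z = bdry_step G A y" by (auto simp: bdry_rel_def)
  then show ?case
  proof cases
    case 1 then show ?thesis using step arc_in vert_of_arc by auto
  next
    case 2
    have z: "z \<in> corners G" using fpf_involutionD(1)[OF fpf_involution_bdry_step[OF A] y] 2 by simp
    show ?thesis
    proof (cases "y \<in> \<Union>A")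
      case True
      then have "(vert_of G y, vert_of G z) \<in> adjacency G A"
        using 2 by (auto simp: adjacency_def bdry_step_def)
      with step z show ?thesis by (auto intro: rtrancl_into_rtrancl)
    next
      case False with step z 2 y show ?thesis by (simp add: bdry_step_def vert_of_seg)
    qed
  qed
qed (use assms in simp)

text \<open>With no edges every boundary step is \<open>seg\<close>, so the walks are the vertex
  circles of \<open>vert_of_eq_iff\<close>.\<close>

lemma card_bdry_comps_empty: "card (bdry_comps G {}) = card (verts G)"
proof -
  have "num_classes (corners G) (bdry_rel G {}) = card (vert_of G ` corners G)"
    unfolding num_classes_def
  proof (rule card_image_eq_if_same_fibres)
    fix x y assume xy: "x \<in> corners G" "y \<in> corners G"
    have "(\<lambda>x. (bdry_rel G {})\<^sup>* `` {x}) = orbit (corners G) (seg G) (arc G)"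
      by (simp add: fun_eq_iff orbit_eq_Image bdry_rel_def bdry_step_def)
    then show "(bdry_rel G {})\<^sup>* `` {x} = (bdry_rel G {})\<^sup>* `` {y} \<longleftrightarrow> vert_of G x = vert_of G y"
      using orbit_eq_iff[of "corners G" "seg G" "arc G" x y] vert_of_eq_iff[OF xy]
        seg_in seg_seg arc_in arc_arc by metis
  qed
  moreover have "card (verts G) = card (vert_of G ` corners G) + card (isolated G)"
    unfolding isolated_def using vert_of_in finite_verts finite_corners
    by (subst card_Un_disjoint[symmetric]) (auto intro!: arg_cong[of _ _ card])
  ultimately show ?thesis using card_bdry_comps[OF finite_corners finite_verts] by simp
qed

text \<open>Equivalently, the Euler genus of a spanning subgraph is not negative. Adding an edge inside a
  component creates at most one boundary component; adding one between two components merges two.\<close>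

lemma Euler_inequality:
  assumes "A \<subseteq> edges G"
  shows "card (bdry_comps G A) + card (verts G) \<le> 2 * num_comp G A + card A"
proof -
  have "finite A" using assms finite_edges by (rule finite_subset)
  then show ?thesis using assms
  proof (induction rule: finite_induct)
    case empty
    have "num_comp G {} = card (verts G)"
      by (simp add: num_comp_eq_num_classes num_classes_def adjacency_def card_image)
    then show ?case by (simp add: card_bdry_comps_empty)
  next
    case (insert e A)
    let ?B = "insert e A"
    have A: "A \<subseteq> edges G" and e: "e \<in> edges G" and B: "?B \<subseteq> edges G" using insert.prems by auto
    then obtain p where p: "p \<in> e" by (auto simp: edges_def)
    note pe = edge_corner[OF e p]
    \<comment> \<open>The boundary of \<open>A\<close> pairs \<open>p\<close> with \<open>q\<close>
      and \<open>r\<close> with \<open>s\<close> along the attaching segments of \<open>e\<close>;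
      with \<open>e\<close> present it pairs \<open>p\<close> with \<open>r\<close> and
      \<open>q\<close> with \<open>s\<close> along the free sides.\<close>
    define q r s where "q = seg G p" and "r = side G p" and "s = seg G r"
    have e_eq: "e = {p, q, r, s}" using pe(2) by (simp add: q_def r_def s_def)
    have disj: "u \<notin> \<Union>A" if "u \<in> e" for u
      using that edges_disjoint[OF e, of _ u] A insert.hyps(2) by blast
    have in_C: "p \<in> corners G" "q \<in> corners G" "r \<in> corners G"
      using pe(1) seg_in side_in by (auto simp: q_def r_def)
    note classes = num_classes_rewire[OF finite_corners fpf_involution_bdry_step[OF A]
        fpf_involution_bdry_step[OF B] fpf_involution_arc, of p q r s, folded bdry_rel_def]
    have vals: "bdry_step G A p = q" "bdry_step G A r = s" "bdry_step G ?B p = r" "bdry_step G ?B q = s"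
      using disj[of p] disj[of r] e_eq pe(1) side_seg[of p]
      by (auto simp: bdry_step_def q_def r_def s_def)
    have off: "bdry_step G A u = bdry_step G ?B u" if "u \<notin> {p, q, r, s}" for u
      using that e_eq by (auto simp: bdry_step_def)
    have le: "card (bdry_comps G ?B) \<le> Suc (card (bdry_comps G A))"
      using classes(1)[OF vals in_C off] card_bdry_comps[OF finite_corners finite_verts] by simp
    have sep: "card (bdry_comps G A) = Suc (card (bdry_comps G ?B))"
      if "(p, r) \<notin> (bdry_rel G A)\<^sup>*"
      using classes(2)[OF vals in_C off that] card_bdry_comps[OF finite_corners finite_verts] by simp
    let ?v = "vert_of G p" and ?w = "vert_of G r"
    have "adjacency G ?B = adjacency G A \<union> {(?v, ?w), (?w, ?v)}"
    proof -
      have "side G r = p" "side G q = s" "side G s = q"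
        using pe(1) side_side[of p] side_seg[of p] side_seg[of r] side_in[of p]
        by (auto simp: q_def r_def s_def)
      moreover have "vert_of G q = ?v" "vert_of G s = ?w"
        using in_C vert_of_seg by (simp_all add: q_def s_def)
      ultimately have "{(vert_of G x, vert_of G (side G x)) | x. x \<in> e} = {(?v, ?w), (?w, ?v)}"
        unfolding e_eq Setcompr_eq_image by (simp add: r_def[symmetric] insert_commute)
      then show ?thesis unfolding adjacency_def by blast
    qed
    then have k: "num_comp G ?B = num_classes (verts G) (adjacency G A \<union> {(?v, ?w), (?w, ?v)})"
      by (simp add: num_comp_eq_num_classes[OF B])
    note IH = insert.IH[OF A]
    show ?case
    \<comment> \<open>Inside a component the left side grows by at most 1 and the right side by 1.
      Between two components the left side falls by 1 and the right side changes by -2 + 1.\<close>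
    proof (cases "(?v, ?w) \<in> (adjacency G A)\<^sup>*")
      case True
      then have "num_comp G ?B = num_comp G A"
        unfolding k num_comp_eq_num_classes[OF A]
        by (rule num_classes_add_pair_same[OF sym_adjacency[OF A]])
      with IH le insert.hyps show ?thesis by simp
    next
      case False
      then have "num_comp G A = Suc (num_comp G ?B)"
        unfolding k num_comp_eq_num_classes[OF A]
        by (intro num_classes_add_pair_diff finite_verts sym_adjacency A vert_of_in in_C)
      moreover have "(p, r) \<notin> (bdry_rel G A)\<^sup>*"
        using False bdry_rel_same_component[OF A _ in_C(1)] by blast
      ultimately show ?thesis using IH sep insert.hyps by simp
    qed
  qed
qed

end

section \<open>The dual\<close>

text \<open>The dual has another vertex type; this form isolates the orbits, which live on the
  shared corner type. Circles of discs without corners always count as closed faces.\<close>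

lemma f_int_eq:
  fixes G :: "('v, 'c) herg_data"
  assumes "finite (corners G)" "finite (verts G)"
  shows "f_int G A = card {W \<in> orbit (corners G) (bdry_step G A) (arc G) ` corners G. W \<inter> hrc G = {}}
      + card (isolated G)"
proof -
  let ?O = "orbit (corners G) (bdry_step G A) (arc G) ` corners G"
  have "{B \<in> bdry_comps G A. \<not> is_external G B}
      = Inl ` {W \<in> ?O. W \<inter> hrc G = {}} \<union> Inr ` isolated G"
    by (auto simp: bdry_comps_def is_external_def isolated_def)
  then have "f_int G A = card (Inl ` {W \<in> ?O. W \<inter> hrc G = {}} :: ('c set + 'v) set)
      + card (Inr ` isolated G :: ('c set + 'v) set)"
    unfolding f_int_def using assms by (simp only:) (intro card_Un_disjoint, auto simp: isolated_def)
  then show ?thesis by (simp add: card_image)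
qed

lemma C_ext_eq:
  "C_ext G A = card {W \<in> orbit (corners G) (bdry_step G A) (arc G) ` corners G. W \<inter> hrc G \<noteq> {}}"
proof -
  let ?O = "orbit (corners G) (bdry_step G A) (arc G) ` corners G"
  have "{B \<in> bdry_comps G A. is_external G B} = Inl ` {W \<in> ?O. W \<inter> hrc G \<noteq> {}}"
    by (auto simp: bdry_comps_def is_external_def)
  then show ?thesis by (simp add: C_ext_def card_image)
qed

context herg
begin

lemma bdry_step_edges: "x \<in> corners G \<Longrightarrow> bdry_step G (edges G) x = (if x \<in> hrc G then seg G x else side G x)"
  unfolding bdry_step_def Union_edges[OF herg_axioms] by simp

text \<open>Exchanging \<open>seg\<close> and \<open>side\<close> only permutes the four corners of
  an edge.\<close>

lemma edges_dual: "edges (dual G) = edges G"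
  unfolding edges_def dual_simps[OF herg_axioms]
proof (rule image_cong[OF refl])
  fix x assume x: "x \<in> corners G - hrc G"
  then have "seg (dual G) x = side G x" "seg (dual G) (seg G x) = seg G (side G x)"
    using seg_not_hrc[OF x] side_seg[OF x] dual_simps(3)[OF herg_axioms] bdry_step_edges by simp_all
  then show "{x, seg (dual G) x, seg G x, seg (dual G) (seg G x)} = {x, seg G x, side G x, seg G (side G x)}"
    by auto
qed

text \<open>Taking the complementary edges compensates for the exchange of \<open>seg\<close> and \<open>side\<close>.\<close>

lemma bdry_step_dual:
  assumes "A \<subseteq> edges G" "x \<in> corners G"
  shows "bdry_step (dual G) (edges G - A) x = bdry_step G A x"
proof -
  have "x \<in> \<Union>(edges G - A) \<longleftrightarrow> x \<notin> hrc G \<and> x \<notin> \<Union>A"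
  proof -
    have "x \<in> \<Union>(edges G) \<longleftrightarrow> x \<notin> hrc G" using Union_edges[OF herg_axioms] assms(2) by simp
    then show ?thesis using edges_disjoint[of _ _ x] assms(1) by blast
  qed
  moreover have "x \<in> \<Union>A \<Longrightarrow> x \<notin> hrc G" using Union_corner(1)[OF assms(1)] by blast
  ultimately show ?thesis
    using assms(2) by (simp add: bdry_step_def[of "dual G"] bdry_step_def[of G A]
        dual_simps[OF herg_axioms] bdry_step_edges)
qed

text \<open>The discs filling the punctures all carry corners of completed half-ribbons.\<close>

lemma isolated_completion: "isolated (completion G) = Inl ` isolated G"
proof -
  have "vert_of (completion G) ` corners (completion G) = Inl ` vert_of G ` corners G \<union> Inr ` half_ribbons G"
    by (simp add: completion_def half_ribbons_def Plus_def image_Un image_image)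
  then show ?thesis by (auto simp: isolated_def completion_def)
qed

text \<open>Every boundary orbit of the completion contains a corner \<open>Inl x\<close>, so the
  corresponding dual vertex keeps a corner. Only the circles of bare discs give bare discs
  again.\<close>

lemma isolated_dual: "isolated (dual G) = Inr ` Inl ` isolated G"
proof -
  let ?K = "completion G"
  let ?o = "orbit (corners ?K) (bdry_step ?K (edges ?K)) (arc ?K)"
  interpret K: herg ?K by (rule herg_completion[OF herg_axioms])
  have vert: "vert_of (dual G) x = Inl (?o (Inl x))" for x
    by (simp add: dual_def loops_to_half_ribbons_def geom_dual_def)
  \<comment> \<open>\<open>Inl x\<close> and \<open>Inr x\<close> are the ends of one free side of
    the completed half-ribbon.\<close>
  have Inr: "?o (Inr x) = ?o (Inl x)" if "x \<in> hrc G" for x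
  proof -
    have x: "x \<in> corners G" using that hrc_subset by auto
    then have "bdry_step ?K (edges ?K) (Inl x) = Inr x"
      using that K.bdry_step_edges[of "Inl x"] by (simp add: completion_def InlI)
    then have "Inr x \<in> ?o (Inl x)"
      using orbit_step1[OF orbit_refl, of "Inl x" "corners ?K" "bdry_step ?K (edges ?K)"] x
      by (simp add: completion_def InlI)
    then have "?o (Inl x) = ?o (Inr x)"
      using orbit_eq_iff[of "corners ?K" "bdry_step ?K (edges ?K)" "arc ?K"]
        fpf_involutionD[OF K.fpf_involution_bdry_step[OF subset_refl]] K.arc_in K.arc_arc by metis
    then show ?thesis ..
  qed
  have "?o ` corners ?K = ?o ` Inl ` corners G"
    using Inr hrc_subset by (force simp: completion_def Plus_def image_Un)
  then have "verts (dual G) = Inl ` ?o ` Inl ` corners G \<union> Inr ` isolated ?K"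
    unfolding dual_simps(6)[OF herg_axioms] bdry_comps_def isolated_def by simp
  then show ?thesis
    by (auto simp: isolated_def[of "dual G"] isolated_completion vert dual_simps(1)[OF herg_axioms])
qed

text \<open>Complementary subgraphs have literally the same boundary orbits, and the half-ribbon
  corners are kept.\<close>

lemma C_ext_dual:
  assumes "A \<subseteq> edges G"
  shows "C_ext (dual G) (edges G - A) = C_ext G A"
  unfolding C_ext_eq dual_simps(1,2)[OF herg_axioms]
  using orbit_cong[of "corners G" "bdry_step (dual G) (edges G - A)" "bdry_step G A" "arc (dual G)" "arc G"]
    bdry_step_dual[OF assms] dual_simps(4)[OF herg_axioms] by simp

lemma f_int_dual:
  assumes "A \<subseteq> edges G"
  shows "f_int (dual G) (edges G - A) = f_int G A"
proof -
  interpret D: herg "dual G" by (rule herg_dual[OF herg_axioms])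
  have "card (isolated (dual G)) = card (isolated G)" by (simp add: isolated_dual card_image)
  then show ?thesis
    unfolding f_int_eq[OF finite_corners finite_verts] f_int_eq[OF D.finite_corners D.finite_verts]
      dual_simps(1,2)[OF herg_axioms]
    using orbit_cong[of "corners G" "bdry_step (dual G) (edges G - A)" "bdry_step G A" "arc (dual G)" "arc G"]
      bdry_step_dual[OF assms] dual_simps(4)[OF herg_axioms] by simp
qed

end

section \<open>Connectedness\<close>

text \<open>Connectedness is moved from vertices to corners, which \<open>G\<close> and its dual
  share. The three kinds of steps are put together so that exchanging \<open>seg\<close> and
  \<open>side\<close> on edges changes nothing.\<close>

definition corner_rel :: "('v, 'c) herg_data \<Rightarrow> ('c \<times> 'c) set" where
  "corner_rel G = steps (corners G) (seg G) \<union> steps (corners G) (arc G)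
     \<union> steps (corners G - hrc G) (side G)"

context herg
begin

lemma herg_connected_iff:
  "herg_connected G \<longleftrightarrow>
    verts G \<noteq> {} \<and> (\<forall>v \<in> verts G. \<forall>w \<in> verts G. (v, w) \<in> (adjacency G (edges G))\<^sup>*)"
proof -
  let ?cl = "\<lambda>v. (adjacency G (edges G))\<^sup>* `` {v}"
  have "herg_connected G \<longleftrightarrow> card (?cl ` verts G) = 1"
    by (simp add: herg_connected_def num_comp_eq_num_classes num_classes_def)
  also have "\<dots> \<longleftrightarrow> verts G \<noteq> {} \<and> (\<forall>v \<in> verts G. \<forall>w \<in> verts G. ?cl v = ?cl w)"
  proof
    assume "card (?cl ` verts G) = 1"
    then obtain X where X: "?cl ` verts G = {X}" by (rule card_1_singletonE)
    have "?cl v = X" if "v \<in> verts G" for v using imageI[OF that, of ?cl] unfolding X by simp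
    with X show "verts G \<noteq> {} \<and> (\<forall>v \<in> verts G. \<forall>w \<in> verts G. ?cl v = ?cl w)" by auto
  next
    assume *: "verts G \<noteq> {} \<and> (\<forall>v \<in> verts G. \<forall>w \<in> verts G. ?cl v = ?cl w)"
    then obtain v where "v \<in> verts G" by blast
    with * have "?cl ` verts G = {?cl v}" by (intro equalityI subsetI) (blast, blast)
    then show "card (?cl ` verts G) = 1" by simp
  qed
  finally show ?thesis
    unfolding rtrancl_classes_eq_iff[OF sym_adjacency[OF subset_refl]] .
qed

text \<open>Corners of one vertex are linked by \<open>seg\<close> and \<open>arc\<close>, and each
  adjacency is one \<open>side\<close> step. The corner \<open>y\<close> is generalized because the
  next edge may leave the vertex at any corner.\<close>

lemma corner_rel_if_adjacent:
  assumes "(vert_of G x, v) \<in> (adjacency G (edges G))\<^sup>*" "v = vert_of G y"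
    and "x \<in> corners G" "y \<in> corners G"
  shows "(x, y) \<in> (corner_rel G)\<^sup>*"
  using assms
proof (induction arbitrary: y rule: rtrancl_induct)
  case base
  then have "(x, y) \<in> (steps (corners G) (seg G) \<union> steps (corners G) (arc G))\<^sup>*"
    using vert_of_eq_iff[of x y] by (simp add: orbit_def)
  then show ?case unfolding corner_rel_def by (meson in_mono rtrancl_mono sup_ge1)
next
  case (step v w)
  then obtain u where u: "u \<in> corners G - hrc G" "v = vert_of G u" "w = vert_of G (side G u)"
    by (auto simp: adjacency_def Union_edges[OF herg_axioms])
  then have su: "side G u \<in> corners G" using side_in by auto
  have "(x, u) \<in> (corner_rel G)\<^sup>*" using step u by simp
  also have "(u, side G u) \<in> corner_rel G" using u by (auto simp: corner_rel_def)
  also have "(side G u, y) \<in> (steps (corners G) (seg G) \<union> steps (corners G) (arc G))\<^sup>*"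
    using vert_of_eq_iff[OF su, of y] u step by (simp add: orbit_def)
  then have "(side G u, y) \<in> (corner_rel G)\<^sup>*"
    unfolding corner_rel_def by (meson in_mono rtrancl_mono sup_ge1)
  finally show ?case .
qed

lemma adjacent_if_corner_rel:
  assumes "(x, y) \<in> (corner_rel G)\<^sup>*"
  shows "(vert_of G x, vert_of G y) \<in> (adjacency G (edges G))\<^sup>*"
  using assms
proof (induction rule: rtrancl_induct)
  case (step y z)
  from step(2) consider "y \<in> corners G" "z = seg G y" | "y \<in> corners G" "z = arc G y"
    | "y \<in> corners G - hrc G" "z = side G y"
    by (auto simp: corner_rel_def)
  then show ?case
  proof cases
    case 3
    then have "(vert_of G y, vert_of G z) \<in> adjacency G (edges G)"
      unfolding adjacency_def Union_edges[OF herg_axioms] by blast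
    with step.IH show ?thesis by (rule rtrancl_into_rtrancl)
  qed (use step.IH vert_of_seg vert_of_arc in auto)
qed simp

lemma corner_rel_dual: "corner_rel (dual G) = corner_rel G"
proof -
  have "steps (corners G) (seg (dual G)) = steps (corners G) (\<lambda>u. if u \<in> hrc G then seg G u else side G u)"
    using dual_simps(3)[OF herg_axioms] bdry_step_edges by auto
  then show ?thesis
    unfolding corner_rel_def dual_simps(1,2,4,5)[OF herg_axioms] by (auto split: if_splits)
qed

text \<open>No edge is attached to a disc without corners, so a connected HERG containing one is
  that single disc.\<close>

lemma connected_isolated:
  assumes "herg_connected G" "v \<in> isolated G"
  shows "verts G = {v}" "corners G = {}"
proof -
  have v: "v \<in> verts G" "\<And>x. x \<in> corners G \<Longrightarrow> vert_of G x \<noteq> v"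
    using assms(2) by (auto simp: isolated_def)
  have "w = v" if "(v, w) \<in> (adjacency G (edges G))\<^sup>*" for w
    using that
  proof (induction rule: rtrancl_induct)
    case (step y z)
    then show ?case using v(2) by (auto simp: adjacency_def Union_edges[OF herg_axioms])
  qed simp
  then show "verts G = {v}" using assms(1) v(1) unfolding herg_connected_iff by blast
  then show "corners G = {}" using v(2) vert_of_in by blast
qed

lemma herg_connected_dual:
  assumes "herg_connected G"
  shows "herg_connected (dual G)"
proof -
  interpret D: herg "dual G" by (rule herg_dual[OF herg_axioms])
  have decomp: "verts (dual G) = isolated (dual G) \<union> vert_of (dual G) ` corners G"
    using D.vert_of_in dual_simps(1)[OF herg_axioms] by (auto simp: isolated_def)
  show ?thesis
  \<comment> \<open>Corners detect connectedness only if every vertex has one; the remaining case is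
    a single bare disc, whose dual is again a single disc.\<close>
  proof (cases "isolated G = {}")
    case True
    then have "verts G = vert_of G ` corners G" using vert_of_in by (auto simp: isolated_def)
    with assms have "corners G \<noteq> {}" by (auto simp: herg_connected_iff)
    moreover have "(vert_of (dual G) x, vert_of (dual G) y) \<in> (adjacency (dual G) (edges (dual G)))\<^sup>*"
      if xy: "x \<in> corners G" "y \<in> corners G" for x y
    proof (rule D.adjacent_if_corner_rel, unfold corner_rel_dual)
      show "(x, y) \<in> (corner_rel G)\<^sup>*"
        using assms xy vert_of_in by (intro corner_rel_if_adjacent) (auto simp: herg_connected_iff)
    qed
    ultimately show ?thesis
      unfolding D.herg_connected_iff decomp using True by (auto simp: isolated_dual)
  next
    case False
    then obtain v where v: "v \<in> isolated G" by blast
    have "isolated G \<subseteq> {v}" using connected_isolated(1)[OF assms v] by (auto simp: isolated_def)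
    with v have "isolated G = {v}" by blast
    then have "verts (dual G) = {Inr (Inl v)}"
      unfolding decomp isolated_dual using connected_isolated(2)[OF assms v] by simp
    then show ?thesis unfolding D.herg_connected_iff by simp
  qed
qed

section \<open>Evaluation of the polynomial\<close>

lemma R_eq_sum:
  fixes a a' b :: "'r::comm_ring_1"
  assumes "herg_connected G" and inv: "a * a' = 1"
  shows "R G (a + 1) a a' b 1 1 = (\<Sum>A \<in> Pow (edges G). a' * a ^ f_int G A * b ^ C_ext G A)"
  unfolding R_def
proof (rule sum.cong[OF refl])
  fix A assume "A \<in> Pow (edges G)"
  then have A: "A \<subseteq> edges G" by simp
  let ?k = "num_comp G A" and ?n = "nullity G A" and ?f = "f_int G A"
  have V: "verts G \<noteq> {}" using assms(1) by (simp add: herg_connected_iff)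
  have k: "1 \<le> ?k" "?k \<le> card (verts G)"
    using V finite_verts card_image_le[OF finite_verts]
    by (simp_all add: num_comp_eq_num_classes[OF A] num_classes_def Suc_le_eq card_gt_0_iff)
  have "finite (bdry_comps G A)" using finite_corners finite_verts by (simp add: bdry_comps_def)
  then have "?f \<le> card (bdry_comps G A)" unfolding f_int_def by (intro card_mono) auto
  \<comment> \<open>Since \<open>?n\<close> is at least \<open>card A - card (verts G) + ?k\<close>,
    the Euler inequality bounds all boundary components by \<open>?k + ?n\<close>.\<close>
  then have f: "?f \<le> ?k + ?n" using Euler_inequality[OF A] k by (simp add: nullity_def rank_def)
  have rank: "rank G (edges G) - rank G A = ?k - 1"
    using assms(1) k by (simp add: rank_def herg_connected_def)
  have cancel: "a ^ m * a' ^ m = 1" for m by (simp add: inv flip: power_mult_distrib)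
  \<comment> \<open>The factor \<open>a' * a = 1\<close> is inserted to turn \<open>?k - 1\<close>
    into \<open>?k\<close>; it leaves the factor \<open>a'\<close> of the result.\<close>
  have "a ^ (?k - 1) * a ^ ?n * a' ^ (?k + ?n - ?f)
      = a' * (a * a ^ (?k - 1)) * a ^ ?n * a' ^ (?k + ?n - ?f)"
    using inv by (simp add: mult.assoc[symmetric] mult.commute[of a'])
  also have "a * a ^ (?k - 1) = a ^ ?k" using k(1) by (simp flip: power_Suc)
  also have "a' * a ^ ?k * a ^ ?n * a' ^ (?k + ?n - ?f) = a' * (a ^ (?k + ?n) * a' ^ (?k + ?n - ?f))"
    by (simp add: power_add mult.assoc)
  also have "a ^ (?k + ?n) = a ^ ?f * a ^ (?k + ?n - ?f)"
    using f by (simp flip: power_add)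
  also have "a' * (a ^ ?f * a ^ (?k + ?n - ?f) * a' ^ (?k + ?n - ?f)) = a' * a ^ ?f"
    using cancel[of "?k + ?n - ?f"] by (simp add: mult.assoc)
  finally show "(a + 1 - 1) ^ (rank G (edges G) - rank G A) * a ^ ?n * a' ^ (?k + ?n - ?f)
      * b ^ C_ext G A * 1 ^ nonor G A * 1 ^ card (half_ribbons G) = a' * a ^ ?f * b ^ C_ext G A"
    unfolding rank by simp
qed

end

theorem theorem4:
  fixes G :: "('v, 'c) herg_data"
  assumes "herg G" and "herg_connected G"
  shows "R G (La + 1) La La_inv Lb 1 1 = R (dual G) (La + 1) La La_inv Lb 1 1"
proof -
  interpret herg G by fact
  interpret D: herg "dual G" by (rule herg_dual[OF assms(1)])
  \<comment> \<open>Taking complements is an involution on the edge subsets and matches each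
    subgraph with its dual counterpart.\<close>
  have "(\<Sum>A \<in> Pow (edges G). La_inv * La ^ f_int G A * Lb ^ C_ext G A)
      = (\<Sum>A \<in> Pow (edges G). La_inv * La ^ f_int (dual G) A * Lb ^ C_ext (dual G) A)"
    by (rule sum.reindex_bij_witness[of _ "\<lambda>A. edges G - A" "\<lambda>A. edges G - A"])
      (auto simp: f_int_dual C_ext_dual double_diff)
  then show ?thesis
    unfolding R_eq_sum[OF assms(2) La_La_inv]
      D.R_eq_sum[OF herg_connected_dual[OF assms(2)] La_La_inv] edges_dual .
qed

end
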